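(* The reduction $\to$ is confluent on typed terms: for every typed term $M$, if $M\to^* N$ and $M\to^* P$, then there is a term $Q$ with $N\to^* Q$ and $P\to^* Q$.
   Context: Types: type expressions are generated by $\sigma ::= t \mid \sigma+\sigma \mid \sigma\times\sigma\mid \sigma\to\sigma\mid \mu t.\sigma\mid \mathrm{void}$ ($t$ type variables); types are closed type expressions. Simple types: $\tau::=\mathrm{void}\mid\tau+\tau\mid\tau\times\tau\mid\tau\to\tau$. The prefix relation $\preceq$ is the least relation with $\mathrm{void}\preceq\tau$ for all types $\tau$ and $\sigma\preceq\sigma',\tau\preceq\tau'\Rightarrow\sigma\star\tau\preceq\sigma'\star\tau'$ ($\star\in\{+,\times,\to\}$, $\sigma,\tau$ simple). Unfolding $\rhd$: least relation with $\mu t.\tau\rhd\tau[\mu t.\tau/t]$, closed under $\star$ in either argument; $\rhd^*$ its reflexive transitive closure; $\tau\!\uparrow=\{\sigma\text{ simple}\mid\exists\tau'(\tau\rhd^*\tau',\sigma\preceq\tau')\}$; $\sigma\approx\tau$ iff $\sigma\!\uparrow=\tau\!\uparrow$. Terms: for each type $\sigma$ there is a countable set of variables $x^\sigma$. Constants, for all types $\sigma,\tau,\rho$ ($\to$ associates to the right): $0_{\sigma,\tau}:\sigma\to(\sigma+\tau)$, $1_{\sigma,\tau}:\tau\to(\sigma+\tau)$, $\mathrm{case}_{\sigma,\tau,\rho}:(\sigma+\tau)\to(\sigma\to\rho)\to(\tau\to\rho)\to\rho$, $\mathrm{pcase}_{\sigma,\tau,\rho}:(\sigma+\tau)\to\rho\to\rho\to\rho$,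 $\mathrm{pair}_{\sigma,\tau}:\sigma\to\tau\to(\sigma\times\tau)$, $\mathrm{fst}_{\sigma,\tau}:(\sigma\times\tau)\to\sigma$, $\mathrm{snd}_{\sigma,\tau}:(\sigma\times\tau)\to\tau$, $\Omega_\sigma:\sigma$. Typing rules: each constant has its given type; $x^\sigma:\sigma$; if $M:\tau$ then $\lambda x^\sigma.M:\sigma\to\tau$; if $M:\sigma\to\tau$ and $N:\sigma$ then $MN:\tau$; if $M:\sigma$ and $\sigma\approx\tau$ then $M:\tau$. A typed term is one derivable by these rules. Terms are identified up to $\alpha$-conversion; $(M,N)$ abbreviates $\mathrm{pair}\,M\,N$. Reduction: $\to$ is the least relation on terms containing $(\lambda x.M)N\to M[x:=N]$ (capture-avoiding substitution), closed under contexts ($M\to M'$ implies $MN\to M'N$, $NM\to NM'$ and $\lambda x.M\to\lambda x.M'$), and containing the following rules, where $x,y,z,w,y_i,z_i$ stand for arbitrary terms: $\mathrm{case}\,(0x)\,y\,z\to y\,x$; $\mathrm{case}\,(1x)\,y\,z\to z\,x$; $\mathrm{fst}\,(x,y)\to x$; $\mathrm{snd}\,(x,y)\to y$; $\mathrm{pcase}\,(0x)\,y\,z\to y$; $\mathrm{pcase}\,(1x)\,y\,z\to z$; $\mathrm{pcase}_{\sigma,\tau,\rho_0+\rho_1}\,x\,(0y)\,(0z)\to 0\,(\mathrm{pcase}_{\sigma,\tau,\rho_0}\,x\,y\,z)$; $\mathrm{pcase}_{\sigma,\tau,\rho_0+\rho_1}\,x\,(1y)\,(1z)\to 1\,(\mathrm{pcase}_{\sigma,\tau,\rho_1}\,x\,y\,z)$;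 $\mathrm{pcase}_{\sigma,\tau,\rho_1\times\rho_2}\,x\,(y_1,y_2)\,(z_1,z_2)\to(\mathrm{pcase}_{\sigma,\tau,\rho_1}\,x\,y_1\,z_1,\ \mathrm{pcase}_{\sigma,\tau,\rho_2}\,x\,y_2\,z_2)$; $(\mathrm{pcase}_{\sigma,\tau,\rho_1\to\rho_2}\,x\,y\,z)\,w\to\mathrm{pcase}_{\sigma,\tau,\rho_2}\,x\,(y\,w)\,(z\,w)$. $\to^*$ is the reflexive transitive closure of $\to$. *)

theory Defs
  imports Main
begin

text \<open>
  Type expressions in de Bruijn form: \<open>TVar n\<close> is bound by the \<open>n\<close>-th enclosing \<open>Mu\<close>.
\<close>

datatype tyop = Plus | Times | Arrow

datatype ty =
    TVar nat
  | TOp tyop ty ty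
  | Mu ty
  | Void

abbreviation TSum :: "ty \<Rightarrow> ty \<Rightarrow> ty" where "TSum \<equiv> TOp Plus"
abbreviation TProd :: "ty \<Rightarrow> ty \<Rightarrow> ty" where "TProd \<equiv> TOp Times"
abbreviation TFun :: "ty \<Rightarrow> ty \<Rightarrow> ty" where "TFun \<equiv> TOp Arrow"

primrec closed_at :: "nat \<Rightarrow> ty \<Rightarrow> bool" where
  "closed_at k (TVar n) \<longleftrightarrow> n < k"
| "closed_at k (TOp s \<sigma> \<tau>) \<longleftrightarrow> closed_at k \<sigma> \<and> closed_at k \<tau>"
| "closed_at k (Mu \<sigma>) \<longleftrightarrow> closed_at (Suc k) \<sigma>"
| "closed_at k Void \<longleftrightarrow> True"

definition is_type :: "ty \<Rightarrow> bool" where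
  "is_type \<sigma> \<longleftrightarrow> closed_at 0 \<sigma>"

primrec simple :: "ty \<Rightarrow> bool" where
  "simple (TVar n) \<longleftrightarrow> False"
| "simple (TOp s \<sigma> \<tau>) \<longleftrightarrow> simple \<sigma> \<and> simple \<tau>"
| "simple (Mu \<sigma>) \<longleftrightarrow> False"
| "simple Void \<longleftrightarrow> True"

primrec ty_lift :: "nat \<Rightarrow> ty \<Rightarrow> ty" where
  "ty_lift k (TVar n) = TVar (if n < k then n else Suc n)"
| "ty_lift k (TOp s \<sigma> \<tau>) = TOp s (ty_lift k \<sigma>) (ty_lift k \<tau>)"
| "ty_lift k (Mu \<sigma>) = Mu (ty_lift (Suc k) \<sigma>)"
| "ty_lift k Void = Void"

primrec ty_subst :: "nat \<Rightarrow> ty \<Rightarrow> ty \<Rightarrow> ty" where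
  "ty_subst k \<rho> (TVar n) = (if n < k then TVar n else if n = k then \<rho> else TVar (n - 1))"
| "ty_subst k \<rho> (TOp s \<sigma> \<tau>) = TOp s (ty_subst k \<rho> \<sigma>) (ty_subst k \<rho> \<tau>)"
| "ty_subst k \<rho> (Mu \<sigma>) = Mu (ty_subst (Suc k) (ty_lift 0 \<rho>) \<sigma>)"
| "ty_subst k \<rho> Void = Void"

inductive prefix_ty :: "ty \<Rightarrow> ty \<Rightarrow> bool" where
  void: "is_type \<tau> \<Longrightarrow> prefix_ty Void \<tau>"
| op: "\<lbrakk>simple \<sigma>; simple \<tau>; prefix_ty \<sigma> \<sigma>'; prefix_ty \<tau> \<tau>'\<rbrakk>
        \<Longrightarrow> prefix_ty (TOp s \<sigma> \<tau>) (TOp s \<sigma>' \<tau>')"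

inductive unfold :: "ty \<Rightarrow> ty \<Rightarrow> bool" where
  mu: "unfold (Mu \<tau>) (ty_subst 0 (Mu \<tau>) \<tau>)"
| left: "unfold \<sigma> \<sigma>' \<Longrightarrow> unfold (TOp s \<sigma> \<tau>) (TOp s \<sigma>' \<tau>)"
| right: "unfold \<tau> \<tau>' \<Longrightarrow> unfold (TOp s \<sigma> \<tau>) (TOp s \<sigma> \<tau>')"

definition up :: "ty \<Rightarrow> ty set" where
  "up \<tau> = {\<sigma>. simple \<sigma> \<and> (\<exists>\<tau>'. unfold\<^sup>*\<^sup>* \<tau> \<tau>' \<and> prefix_ty \<sigma> \<tau>')}"

definition ty_equiv :: "ty \<Rightarrow> ty \<Rightarrow> bool" where
  "ty_equiv \<sigma> \<tau> \<longleftrightarrow> up \<sigma> = up \<tau>"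

datatype const =
    In0 ty ty
  | In1 ty ty
  | Case ty ty ty
  | PCase ty ty ty
  | Pair ty ty
  | Fst ty ty
  | Snd ty ty
  | Omega ty

primrec const_type :: "const \<Rightarrow> ty" where
  "const_type (In0 \<sigma> \<tau>) = TFun \<sigma> (TSum \<sigma> \<tau>)"
| "const_type (In1 \<sigma> \<tau>) = TFun \<tau> (TSum \<sigma> \<tau>)"
| "const_type (Case \<sigma> \<tau> \<rho>) =
     TFun (TSum \<sigma> \<tau>) (TFun (TFun \<sigma> \<rho>) (TFun (TFun \<tau> \<rho>) \<rho>))"
| "const_type (PCase \<sigma> \<tau> \<rho>) = TFun (TSum \<sigma> \<tau>) (TFun \<rho> (TFun \<rho> \<rho>))"
| "const_type (Pair \<sigma> \<tau>) = TFun \<sigma> (TFun \<tau> (TProd \<sigma> \<tau>))"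
| "const_type (Fst \<sigma> \<tau>) = TFun (TProd \<sigma> \<tau>) \<sigma>"
| "const_type (Snd \<sigma> \<tau>) = TFun (TProd \<sigma> \<tau>) \<tau>"
| "const_type (Omega \<sigma>) = \<sigma>"

text \<open>
  Terms up to alpha-conversion: \<open>Free n \<sigma>\<close> is the \<open>n\<close>-th variable of type \<open>\<sigma>\<close>, occurring free;
  an occurrence bound by a \<open>Lam\<close> is a de Bruijn index \<open>Bound i\<close>.  Raw terms with dangling indices
  are the bodies of abstractions; they are not terms in their own right, and are not typable in
  the empty context.
\<close>

datatype trm =
    Const const
  | Free nat ty
  | Bound nat
  | Lam ty trm
  | App trm trm  (infixl \<open>\<bullet>\<close> 200)

primrec lift :: "nat \<Rightarrow> trm \<Rightarrow> trm" where
  "lift k (Const c) = Const c"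
| "lift k (Free n \<sigma>) = Free n \<sigma>"
| "lift k (Bound i) = Bound (if i < k then i else Suc i)"
| "lift k (Lam \<sigma> M) = Lam \<sigma> (lift (Suc k) M)"
| "lift k (M \<bullet> N) = lift k M \<bullet> lift k N"

primrec subst :: "nat \<Rightarrow> trm \<Rightarrow> trm \<Rightarrow> trm" where
  "subst k L (Const c) = Const c"
| "subst k L (Free n \<sigma>) = Free n \<sigma>"
| "subst k L (Bound i) = (if i < k then Bound i else if i = k then L else Bound (i - 1))"
| "subst k L (Lam \<sigma> M) = Lam \<sigma> (subst (Suc k) (lift 0 L) M)"
| "subst k L (M \<bullet> N) = subst k L M \<bullet> subst k L N"

text \<open>
  The context lists the types of the enclosing abstractions, innermost first.  In rule \<open>const\<close>
  the premise makes all subscripts of \<open>c\<close> closed, since each of them occurs in \<open>const_type c\<close>.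
\<close>

inductive has_type :: "ty list \<Rightarrow> trm \<Rightarrow> ty \<Rightarrow> bool" where
  const: "is_type (const_type c) \<Longrightarrow> has_type \<Gamma> (Const c) (const_type c)"
| free: "is_type \<sigma> \<Longrightarrow> has_type \<Gamma> (Free n \<sigma>) \<sigma>"
| bound: "i < length \<Gamma> \<Longrightarrow> has_type \<Gamma> (Bound i) (\<Gamma> ! i)"
| lam: "\<lbrakk>is_type \<sigma>; has_type (\<sigma> # \<Gamma>) M \<tau>\<rbrakk> \<Longrightarrow> has_type \<Gamma> (Lam \<sigma> M) (TFun \<sigma> \<tau>)"
| app: "\<lbrakk>has_type \<Gamma> M (TFun \<sigma> \<tau>); has_type \<Gamma> N \<sigma>\<rbrakk> \<Longrightarrow> has_type \<Gamma> (M \<bullet> N) \<tau>"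
| conv: "\<lbrakk>has_type \<Gamma> M \<sigma>; ty_equiv \<sigma> \<tau>; is_type \<tau>\<rbrakk> \<Longrightarrow> has_type \<Gamma> M \<tau>"

definition typed :: "trm \<Rightarrow> bool" where
  "typed M \<longleftrightarrow> (\<exists>\<sigma>. has_type [] M \<sigma>)"

text \<open>
  Constants keep their type subscripts.  Subscripts that the informal rules leave out are arbitrary,
  but in the three rules that move \<open>pcase\<close> below a constructor all occurrences of that constructor
  are the same constant.  Confluence fails if the two arguments may there carry subscripts that agree
  only up to \<^const>\<open>ty_equiv\<close>: with arguments \<open>0\<^sub>a y\<close> and \<open>0\<^sub>b z\<close>, the scrutinee \<open>0 u\<close> also gives the
  reduct \<open>0\<^sub>a y\<close>, and the scrutinee \<open>1 u\<close> the reduct \<open>0\<^sub>b z\<close>, so the contractum would have to start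
  with both \<open>0\<^sub>a\<close> and \<open>0\<^sub>b\<close>.
\<close>

inductive red :: "trm \<Rightarrow> trm \<Rightarrow> bool"  (infix \<open>\<rightarrow>\<^sub>r\<close> 50) where
  beta: "Lam \<sigma> M \<bullet> N \<rightarrow>\<^sub>r subst 0 N M"
| appL: "M \<rightarrow>\<^sub>r M' \<Longrightarrow> M \<bullet> N \<rightarrow>\<^sub>r M' \<bullet> N"
| appR: "M \<rightarrow>\<^sub>r M' \<Longrightarrow> N \<bullet> M \<rightarrow>\<^sub>r N \<bullet> M'"
| lam: "M \<rightarrow>\<^sub>r M' \<Longrightarrow> Lam \<sigma> M \<rightarrow>\<^sub>r Lam \<sigma> M'"
| case0: "Const (Case \<sigma> \<tau> \<rho>) \<bullet> (Const (In0 \<sigma>' \<tau>') \<bullet> x) \<bullet> y \<bullet> z \<rightarrow>\<^sub>r y \<bullet> x"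
| case1: "Const (Case \<sigma> \<tau> \<rho>) \<bullet> (Const (In1 \<sigma>' \<tau>') \<bullet> x) \<bullet> y \<bullet> z \<rightarrow>\<^sub>r z \<bullet> x"
| fst: "Const (Fst \<sigma> \<tau>) \<bullet> (Const (Pair \<sigma>' \<tau>') \<bullet> x \<bullet> y) \<rightarrow>\<^sub>r x"
| snd: "Const (Snd \<sigma> \<tau>) \<bullet> (Const (Pair \<sigma>' \<tau>') \<bullet> x \<bullet> y) \<rightarrow>\<^sub>r y"
| pcase0: "Const (PCase \<sigma> \<tau> \<rho>) \<bullet> (Const (In0 \<sigma>' \<tau>') \<bullet> x) \<bullet> y \<bullet> z \<rightarrow>\<^sub>r y"
| pcase1: "Const (PCase \<sigma> \<tau> \<rho>) \<bullet> (Const (In1 \<sigma>' \<tau>') \<bullet> x) \<bullet> y \<bullet> z \<rightarrow>\<^sub>r z"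
| pcase_in0:
    "Const (PCase \<sigma> \<tau> (TSum \<rho>\<^sub>0 \<rho>\<^sub>1)) \<bullet> x \<bullet> (Const (In0 \<rho>\<^sub>0' \<rho>\<^sub>1') \<bullet> y) \<bullet> (Const (In0 \<rho>\<^sub>0' \<rho>\<^sub>1') \<bullet> z)
     \<rightarrow>\<^sub>r Const (In0 \<rho>\<^sub>0' \<rho>\<^sub>1') \<bullet> (Const (PCase \<sigma> \<tau> \<rho>\<^sub>0) \<bullet> x \<bullet> y \<bullet> z)"
| pcase_in1:
    "Const (PCase \<sigma> \<tau> (TSum \<rho>\<^sub>0 \<rho>\<^sub>1)) \<bullet> x \<bullet> (Const (In1 \<rho>\<^sub>0' \<rho>\<^sub>1') \<bullet> y) \<bullet> (Const (In1 \<rho>\<^sub>0' \<rho>\<^sub>1') \<bullet> z)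
     \<rightarrow>\<^sub>r Const (In1 \<rho>\<^sub>0' \<rho>\<^sub>1') \<bullet> (Const (PCase \<sigma> \<tau> \<rho>\<^sub>1) \<bullet> x \<bullet> y \<bullet> z)"
| pcase_pair:
    "Const (PCase \<sigma> \<tau> (TProd \<rho>\<^sub>1 \<rho>\<^sub>2)) \<bullet> x
       \<bullet> (Const (Pair \<rho>\<^sub>1' \<rho>\<^sub>2') \<bullet> y\<^sub>1 \<bullet> y\<^sub>2) \<bullet> (Const (Pair \<rho>\<^sub>1' \<rho>\<^sub>2') \<bullet> z\<^sub>1 \<bullet> z\<^sub>2)
     \<rightarrow>\<^sub>r Const (Pair \<rho>\<^sub>1' \<rho>\<^sub>2') \<bullet> (Const (PCase \<sigma> \<tau> \<rho>\<^sub>1) \<bullet> x \<bullet> y\<^sub>1 \<bullet> z\<^sub>1)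
                          \<bullet> (Const (PCase \<sigma> \<tau> \<rho>\<^sub>2) \<bullet> x \<bullet> y\<^sub>2 \<bullet> z\<^sub>2)"
| pcase_fun:
    "Const (PCase \<sigma> \<tau> (TFun \<rho>\<^sub>1 \<rho>\<^sub>2)) \<bullet> x \<bullet> y \<bullet> z \<bullet> w
     \<rightarrow>\<^sub>r Const (PCase \<sigma> \<tau> \<rho>\<^sub>2) \<bullet> x \<bullet> (y \<bullet> w) \<bullet> (z \<bullet> w)"

end

theory Submission
  imports Defs "HOL-Library.Confluence"
begin

text \<open>
  The proof uses Aczel's variant of parallel reduction, in which an application may be contracted
  at the root after its two parts have been reduced.  The only overlaps between the rules are those
  of the projections \<open>pcase (0 x) y z \<rightarrow> y\<close> and \<open>pcase (1 x) y z \<rightarrow> z\<close> with the rules that move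
  \<open>pcase\<close> inwards.  Every such pair is joined by projecting in the other reduct, so if projections
  take priority over moving \<open>pcase\<close>, then reducing everything bottom-up yields a greatest parallel
  reduct of each term.  This gives the diamond property of parallel reduction.
\<close>

section \<open>Substitution\<close>

lemma lift_lift: "i < Suc k \<Longrightarrow> lift (Suc k) (lift i t) = lift i (lift k t)"
  by (induction t arbitrary: i k) auto

lemma lift_subst:
  "j < Suc i \<Longrightarrow> lift i (subst j s t) = subst j (lift i s) (lift (Suc i) t)"
  by (induction t arbitrary: i j s) (auto simp: lift_lift)

lemma lift_subst_less:
  "i < Suc j \<Longrightarrow> lift i (subst j s t) = subst (Suc j) (lift i s) (lift i t)"
  by (induction t arbitrary: i j s) (auto simp: lift_lift)

lemma subst_lift [simp]: "subst k s (lift k t) = t"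
  by (induction t arbitrary: k s) auto

text \<open>The substitution lemma of the lambda calculus in de Bruijn form. It makes beta stable
  under substitution in \<open>contract_subst\<close>.\<close>

lemma subst_subst:
  "i < Suc j \<Longrightarrow> subst i (subst j v u) (subst (Suc j) (lift i v) t) = subst j v (subst i u t)"
  by (induction t arbitrary: i j u v) (auto simp: lift_lift [symmetric] lift_subst_less)

section \<open>Root contraction\<close>

text \<open>The rules are split into this relation and \<open>pcase_push\<close> because every
  overlap at the root is between the two. Within each one the left-hand sides exclude one another,
  so each is a partial function.\<close>

inductive contract :: "trm \<Rightarrow> trm \<Rightarrow> bool" where
  beta: "contract (Lam \<sigma> M \<bullet> N) (subst 0 N M)"
| case0: "contract (Const (Case \<sigma> \<tau> \<rho>) \<bullet> (Const (In0 \<sigma>' \<tau>') \<bullet> x) \<bullet> y \<bullet> z) (y \<bullet> x)"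
| case1: "contract (Const (Case \<sigma> \<tau> \<rho>) \<bullet> (Const (In1 \<sigma>' \<tau>') \<bullet> x) \<bullet> y \<bullet> z) (z \<bullet> x)"
| fst: "contract (Const (Fst \<sigma> \<tau>) \<bullet> (Const (Pair \<sigma>' \<tau>') \<bullet> x \<bullet> y)) x"
| snd: "contract (Const (Snd \<sigma> \<tau>) \<bullet> (Const (Pair \<sigma>' \<tau>') \<bullet> x \<bullet> y)) y"
| pcase0: "contract (Const (PCase \<sigma> \<tau> \<rho>) \<bullet> (Const (In0 \<sigma>' \<tau>') \<bullet> x) \<bullet> y \<bullet> z) y"
| pcase1: "contract (Const (PCase \<sigma> \<tau> \<rho>) \<bullet> (Const (In1 \<sigma>' \<tau>') \<bullet> x) \<bullet> y \<bullet> z) z"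

inductive pcase_push :: "trm \<Rightarrow> trm \<Rightarrow> bool" where
  in0: "pcase_push
    (Const (PCase \<sigma> \<tau> (TSum \<rho>\<^sub>0 \<rho>\<^sub>1)) \<bullet> x \<bullet> (Const (In0 \<rho>\<^sub>0' \<rho>\<^sub>1') \<bullet> y) \<bullet> (Const (In0 \<rho>\<^sub>0' \<rho>\<^sub>1') \<bullet> z))
    (Const (In0 \<rho>\<^sub>0' \<rho>\<^sub>1') \<bullet> (Const (PCase \<sigma> \<tau> \<rho>\<^sub>0) \<bullet> x \<bullet> y \<bullet> z))"
| in1: "pcase_push
    (Const (PCase \<sigma> \<tau> (TSum \<rho>\<^sub>0 \<rho>\<^sub>1)) \<bullet> x \<bullet> (Const (In1 \<rho>\<^sub>0' \<rho>\<^sub>1') \<bullet> y) \<bullet> (Const (In1 \<rho>\<^sub>0' \<rho>\<^sub>1') \<bullet> z))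
    (Const (In1 \<rho>\<^sub>0' \<rho>\<^sub>1') \<bullet> (Const (PCase \<sigma> \<tau> \<rho>\<^sub>1) \<bullet> x \<bullet> y \<bullet> z))"
| pair: "pcase_push
    (Const (PCase \<sigma> \<tau> (TProd \<rho>\<^sub>1 \<rho>\<^sub>2)) \<bullet> x
       \<bullet> (Const (Pair \<rho>\<^sub>1' \<rho>\<^sub>2') \<bullet> y\<^sub>1 \<bullet> y\<^sub>2) \<bullet> (Const (Pair \<rho>\<^sub>1' \<rho>\<^sub>2') \<bullet> z\<^sub>1 \<bullet> z\<^sub>2))
    (Const (Pair \<rho>\<^sub>1' \<rho>\<^sub>2') \<bullet> (Const (PCase \<sigma> \<tau> \<rho>\<^sub>1) \<bullet> x \<bullet> y\<^sub>1 \<bullet> z\<^sub>1)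
                         \<bullet> (Const (PCase \<sigma> \<tau> \<rho>\<^sub>2) \<bullet> x \<bullet> y\<^sub>2 \<bullet> z\<^sub>2))"
| func: "pcase_push
    (Const (PCase \<sigma> \<tau> (TFun \<rho>\<^sub>1 \<rho>\<^sub>2)) \<bullet> x \<bullet> y \<bullet> z \<bullet> w)
    (Const (PCase \<sigma> \<tau> \<rho>\<^sub>2) \<bullet> x \<bullet> (y \<bullet> w) \<bullet> (z \<bullet> w))"

definition root_red :: "trm \<Rightarrow> trm \<Rightarrow> bool" where
  "root_red M N \<longleftrightarrow> contract M N \<or> pcase_push M N"

lemma contract_unique: "contract M N \<Longrightarrow> contract M N' \<Longrightarrow> N = N'"
  by (induction rule: contract.induct) (auto elim: contract.cases)

lemma pcase_push_unique: "pcase_push M N \<Longrightarrow> pcase_push M N' \<Longrightarrow> N = N'"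
  by (induction rule: pcase_push.induct) (auto elim: pcase_push.cases)

lemma contract_lift: "contract M N \<Longrightarrow> contract (lift k M) (lift k N)"
  by (induction rule: contract.induct) (auto simp: lift_subst intro: contract.intros)

lemma pcase_push_lift: "pcase_push M N \<Longrightarrow> pcase_push (lift k M) (lift k N)"
  by (induction rule: pcase_push.induct) (auto intro: pcase_push.intros)

lemma root_red_lift: "root_red M N \<Longrightarrow> root_red (lift k M) (lift k N)"
  by (auto simp: root_red_def contract_lift pcase_push_lift)

lemma contract_subst: "contract M N \<Longrightarrow> contract (subst k L M) (subst k L N)"
  by (induction rule: contract.induct) (auto simp: subst_subst [symmetric] intro: contract.intros)

lemma pcase_push_subst: "pcase_push M N \<Longrightarrow> pcase_push (subst k L M) (subst k L N)"
  by (induction rule: pcase_push.induct) (auto intro: pcase_push.intros)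

lemma root_red_subst: "root_red M N \<Longrightarrow> root_red (subst k L M) (subst k L N)"
  by (auto simp: root_red_def contract_subst pcase_push_subst)

lemma root_red_imp_red: "root_red M N \<Longrightarrow> M \<rightarrow>\<^sub>r N"
  by (auto simp: root_red_def elim!: contract.cases pcase_push.cases intro: red.intros)

section \<open>Parallel reduction\<close>

text \<open>In \<open>root\<close> the redex is sought in \<open>M' \<bullet> N'\<close>, so a step
  may contract a redex that it has just created. The triangle needs this: after a push,
  \<open>pcase x y z\<close> must project in one step even if \<open>x\<close> only becomes an
  injection during that step.\<close>

inductive par :: "trm \<Rightarrow> trm \<Rightarrow> bool"  (infix \<open>\<Rrightarrow>\<close> 50) where
  const: "Const c \<Rrightarrow> Const c"
| free: "Free n \<sigma> \<Rrightarrow> Free n \<sigma>"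
| bound: "Bound i \<Rrightarrow> Bound i"
| lam: "M \<Rrightarrow> M' \<Longrightarrow> Lam \<sigma> M \<Rrightarrow> Lam \<sigma> M'"
| app: "\<lbrakk>M \<Rrightarrow> M'; N \<Rrightarrow> N'\<rbrakk> \<Longrightarrow> M \<bullet> N \<Rrightarrow> M' \<bullet> N'"
| root: "\<lbrakk>M \<Rrightarrow> M'; N \<Rrightarrow> N'; root_red (M' \<bullet> N') L\<rbrakk> \<Longrightarrow> M \<bullet> N \<Rrightarrow> L"

lemma par_refl [simp]: "M \<Rrightarrow> M"
  by (induction M) (auto intro: par.intros)

inductive_cases par_ConstE [elim!]: "Const c \<Rrightarrow> M"
inductive_cases par_FreeE: "Free n \<sigma> \<Rrightarrow> M"
inductive_cases par_BoundE: "Bound i \<Rrightarrow> M"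
inductive_cases par_LamE [elim!]: "Lam \<sigma> M \<Rrightarrow> N"
inductive_cases par_AppE: "M \<bullet> N \<Rrightarrow> L"

lemma par_lift: "M \<Rrightarrow> N \<Longrightarrow> lift k M \<Rrightarrow> lift k N"
proof (induction arbitrary: k rule: par.induct)
  case (root M M' N N' L)
  then show ?case using root_red_lift [of "M' \<bullet> N'" L k] by (auto intro: par.root)
qed (auto intro: par.intros)

lemma par_subst: "M \<Rrightarrow> M' \<Longrightarrow> N \<Rrightarrow> N' \<Longrightarrow> subst k N M \<Rrightarrow> subst k N' M'"
proof (induction arbitrary: k N N' rule: par.induct)
  case (root M M' L L' R)
  then show ?case
    using par.root [OF root.IH(1) [OF root.prems] root.IH(2) [OF root.prems]]
      root_red_subst [OF root.hyps(3)] by simp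
qed (auto intro!: par.lam intro: par.app par_lift)

section \<open>Parallel reduction lies between one-step and many-step reduction\<close>

text \<open>Every left-hand side is an application, so the case split on \<open>M\<close> exposes
  two parts to which \<open>par.root\<close> applies with reflexive premises.\<close>

lemma contract_imp_par: "contract M N \<Longrightarrow> M \<Rrightarrow> N"
  by (cases M)
    (auto simp: root_red_def intro: par.root [OF par_refl par_refl] elim: contract.cases)

lemma pcase_push_imp_par: "pcase_push M N \<Longrightarrow> M \<Rrightarrow> N"
  by (cases M)
    (auto simp: root_red_def intro: par.root [OF par_refl par_refl] elim: pcase_push.cases)

lemma red_imp_par: "M \<rightarrow>\<^sub>r N \<Longrightarrow> M \<Rrightarrow> N"
  by (induction rule: red.induct)
    (auto intro: par.lam par.app contract_imp_par contract.intros pcase_push_imp_par pcase_push.intros)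

lemma reds_lam: "red\<^sup>*\<^sup>* M M' \<Longrightarrow> red\<^sup>*\<^sup>* (Lam \<sigma> M) (Lam \<sigma> M')"
  by (induction rule: rtranclp_induct) (auto intro: red.lam rtranclp.rtrancl_into_rtrancl)

lemma reds_app: "red\<^sup>*\<^sup>* M M' \<Longrightarrow> red\<^sup>*\<^sup>* N N' \<Longrightarrow> red\<^sup>*\<^sup>* (M \<bullet> N) (M' \<bullet> N')"
proof -
  assume "red\<^sup>*\<^sup>* M M'" and *: "red\<^sup>*\<^sup>* N N'"
  then have "red\<^sup>*\<^sup>* (M \<bullet> N) (M' \<bullet> N)"
    by (induction rule: rtranclp_induct) (auto intro: red.appL rtranclp.rtrancl_into_rtrancl)
  also from * have "red\<^sup>*\<^sup>* (M' \<bullet> N) (M' \<bullet> N')"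
    by (induction rule: rtranclp_induct) (auto intro: red.appR rtranclp.rtrancl_into_rtrancl)
  finally show ?thesis .
qed

lemma par_imp_reds: "M \<Rrightarrow> N \<Longrightarrow> red\<^sup>*\<^sup>* M N"
proof (induction rule: par.induct)
  case (root M M' N N' L)
  then show ?case
    by (meson reds_app root_red_imp_red rtranclp.rtrancl_into_rtrancl)
qed (auto intro: reds_lam reds_app)

section \<open>The triangle property\<close>

text \<open>Contraction comes first because a projection can still be carried out after a push,
  inside the pushed term, whereas a projection destroys the redex of the push.\<close>

definition greatest_root_reduct :: "trm \<Rightarrow> trm \<Rightarrow> bool" where
  "greatest_root_reduct M L \<longleftrightarrow>
     (if \<exists>N. contract M N then contract M L
      else if \<exists>N. pcase_push M N then pcase_push M L else L = M)"

lemma greatest_root_reduct_exists: "\<exists>L. greatest_root_reduct M L"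
  by (cases "\<exists>N. contract M N"; cases "\<exists>N. pcase_push M N")
    (auto simp: greatest_root_reduct_def)

lemma greatest_root_reduct_contract:
  "greatest_root_reduct M L \<Longrightarrow> contract M N \<Longrightarrow> L = N"
  by (auto simp: greatest_root_reduct_def dest: contract_unique split: if_splits)

lemma greatest_root_reduct_push:
  "greatest_root_reduct M L \<Longrightarrow> pcase_push M N \<Longrightarrow> contract M L \<or> L = N"
  by (auto simp: greatest_root_reduct_def dest: pcase_push_unique split: if_splits)

text \<open>The three branches of the definition match the rules \<open>root\<close> (contraction or
  push) and \<open>app\<close> (no root redex).\<close>

lemma par_greatest_root_reduct:
  "M \<Rrightarrow> M' \<Longrightarrow> N \<Rrightarrow> N' \<Longrightarrow> greatest_root_reduct (M' \<bullet> N') L \<Longrightarrow> M \<bullet> N \<Rrightarrow> L"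
  by (auto simp: greatest_root_reduct_def root_red_def intro: par.app par.root split: if_splits)

section \<open>Inversion of parallel steps from applied constants\<close>

text \<open>No left-hand side has an injection or \<open>Pair\<close> as its head, so a step can
  only act on the arguments. The same holds for \<open>Case\<close> and \<open>PCase\<close> with at
  most two arguments, since their rules need a third.\<close>

lemma par_In0E:
  assumes "Const (In0 \<sigma> \<tau>) \<bullet> x \<Rrightarrow> L"
  obtains x' where "L = Const (In0 \<sigma> \<tau>) \<bullet> x'" "x \<Rrightarrow> x'"
  using assms by (elim par_AppE) (auto simp: root_red_def elim: contract.cases pcase_push.cases)

lemma par_In1E:
  assumes "Const (In1 \<sigma> \<tau>) \<bullet> x \<Rrightarrow> L"
  obtains x' where "L = Const (In1 \<sigma> \<tau>) \<bullet> x'" "x \<Rrightarrow> x'"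
  using assms by (elim par_AppE) (auto simp: root_red_def elim: contract.cases pcase_push.cases)

lemma par_Pair1E:
  assumes "Const (Pair \<sigma> \<tau>) \<bullet> x \<Rrightarrow> L"
  obtains x' where "L = Const (Pair \<sigma> \<tau>) \<bullet> x'" "x \<Rrightarrow> x'"
  using assms by (elim par_AppE) (auto simp: root_red_def elim: contract.cases pcase_push.cases)

lemma par_PairE:
  assumes "Const (Pair \<sigma> \<tau>) \<bullet> x \<bullet> y \<Rrightarrow> L"
  obtains x' y' where "L = Const (Pair \<sigma> \<tau>) \<bullet> x' \<bullet> y'" "x \<Rrightarrow> x'" "y \<Rrightarrow> y'"
  using assms
  by (elim par_AppE) (auto simp: root_red_def elim!: par_Pair1E elim: contract.cases pcase_push.cases)

lemma par_Case1E:
  assumes "Const (Case \<sigma> \<tau> \<rho>) \<bullet> x \<Rrightarrow> L"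
  obtains x' where "L = Const (Case \<sigma> \<tau> \<rho>) \<bullet> x'" "x \<Rrightarrow> x'"
  using assms by (elim par_AppE) (auto simp: root_red_def elim: contract.cases pcase_push.cases)

lemma par_Case2E:
  assumes "Const (Case \<sigma> \<tau> \<rho>) \<bullet> x \<bullet> y \<Rrightarrow> L"
  obtains x' y' where "L = Const (Case \<sigma> \<tau> \<rho>) \<bullet> x' \<bullet> y'" "x \<Rrightarrow> x'" "y \<Rrightarrow> y'"
  using assms
  by (elim par_AppE) (auto simp: root_red_def elim!: par_Case1E elim: contract.cases pcase_push.cases)

lemma par_PCase1E:
  assumes "Const (PCase \<sigma> \<tau> \<rho>) \<bullet> x \<Rrightarrow> L"
  obtains x' where "L = Const (PCase \<sigma> \<tau> \<rho>) \<bullet> x'" "x \<Rrightarrow> x'"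
  using assms by (elim par_AppE) (auto simp: root_red_def elim: contract.cases pcase_push.cases)

lemma par_PCase2E:
  assumes "Const (PCase \<sigma> \<tau> \<rho>) \<bullet> x \<bullet> y \<Rrightarrow> L"
  obtains x' y' where "L = Const (PCase \<sigma> \<tau> \<rho>) \<bullet> x' \<bullet> y'" "x \<Rrightarrow> x'" "y \<Rrightarrow> y'"
  using assms
  by (elim par_AppE) (auto simp: root_red_def elim!: par_PCase1E elim: contract.cases pcase_push.cases)

text \<open>This is the left part of a \<open>pcase_push.func\<close> redex, and the only left part
  of a redex that can itself be contracted at the root: its scrutinee may become an
  injection.\<close>

lemma par_PCase_fun3E:
  assumes "Const (PCase \<sigma> \<tau> (TFun \<rho>\<^sub>1 \<rho>\<^sub>2)) \<bullet> x \<bullet> y \<bullet> z \<Rrightarrow> L"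
  obtains (cong) x' y' z' where "L = Const (PCase \<sigma> \<tau> (TFun \<rho>\<^sub>1 \<rho>\<^sub>2)) \<bullet> x' \<bullet> y' \<bullet> z'"
      "x \<Rrightarrow> x'" "y \<Rrightarrow> y'" "z \<Rrightarrow> z'"
  | (proj0) \<sigma>' \<tau>' u where "x \<Rrightarrow> Const (In0 \<sigma>' \<tau>') \<bullet> u" "y \<Rrightarrow> L"
  | (proj1) \<sigma>' \<tau>' u where "x \<Rrightarrow> Const (In1 \<sigma>' \<tau>') \<bullet> u" "z \<Rrightarrow> L"
proof -
  from assms obtain M' z' where M': "Const (PCase \<sigma> \<tau> (TFun \<rho>\<^sub>1 \<rho>\<^sub>2)) \<bullet> x \<bullet> y \<Rrightarrow> M'" and z': "z \<Rrightarrow> z'"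
    and L: "L = M' \<bullet> z' \<or> root_red (M' \<bullet> z') L"
    by (cases rule: par_AppE) auto
  from M' obtain x' y' where M': "M' = Const (PCase \<sigma> \<tau> (TFun \<rho>\<^sub>1 \<rho>\<^sub>2)) \<bullet> x' \<bullet> y'" "x \<Rrightarrow> x'" "y \<Rrightarrow> y'"
    by (rule par_PCase2E)
  from L consider "L = M' \<bullet> z'" | "contract (M' \<bullet> z') L" | "pcase_push (M' \<bullet> z') L"
    by (auto simp: root_red_def)
  then show thesis
  proof cases
    case 1
    with M' z' show thesis by (auto intro: cong)
  next
    case 2
    then show thesis using M' z' proj0 proj1 by cases auto
  next
    case 3
    \<comment> \<open>Impossible: at a function type a push needs a fourth argument, and the other
      pushes need a sum or product subscript.\<close>
    then show thesis using M' by cases auto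
  qed
qed

lemma par_pcase:
  "x \<Rrightarrow> x' \<Longrightarrow> y \<Rrightarrow> y' \<Longrightarrow> z \<Rrightarrow> z' \<Longrightarrow>
    Const (PCase \<sigma> \<tau> \<rho>) \<bullet> x \<bullet> y \<bullet> z \<Rrightarrow> Const (PCase \<sigma> \<tau> \<rho>) \<bullet> x' \<bullet> y' \<bullet> z'"
  by (intro par.app par.const)

text \<open>The scrutinee need not be an injection yet: \<open>par.root\<close> first reduces it to
  one and then projects.\<close>

lemma par_pcase0:
  "x \<Rrightarrow> Const (In0 \<sigma>' \<tau>') \<bullet> u \<Longrightarrow> y \<Rrightarrow> y' \<Longrightarrow> Const (PCase \<sigma> \<tau> \<rho>) \<bullet> x \<bullet> y \<bullet> z \<Rrightarrow> y'"
  using par.root [OF par.app [OF par.app [OF par.const]] par_refl] contract.pcase0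
  unfolding root_red_def by blast

lemma par_pcase1:
  "x \<Rrightarrow> Const (In1 \<sigma>' \<tau>') \<bullet> u \<Longrightarrow> z \<Rrightarrow> z' \<Longrightarrow> Const (PCase \<sigma> \<tau> \<rho>) \<bullet> x \<bullet> y \<bullet> z \<Rrightarrow> z'"
  using par.root [OF par.app [OF par.app [OF par.const] par_refl]] contract.pcase1
  unfolding root_red_def by blast

text \<open>Reducing the two parts of a redex keeps its pattern, with \<open>func\<close> as the
  only exception. Hence \<open>M' \<bullet> N'\<close> is a redex of the same rule, and
  \<open>P\<close> reaches its contractum by reducing the components. The remaining work is where
  \<open>L\<close> arises from a projection instead of a push.\<close>

lemma root_red_triangle:
  assumes M: "M \<Rrightarrow> M'" and N: "N \<Rrightarrow> N'"
    and L: "greatest_root_reduct (M' \<bullet> N') L" and P: "root_red (M \<bullet> N) P"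
  shows "P \<Rrightarrow> L"
proof -
  note contractD = greatest_root_reduct_contract [OF L]
  from P consider (contract) "contract (M \<bullet> N) P" | (push) "pcase_push (M \<bullet> N) P"
    by (auto simp: root_red_def)
  then show ?thesis
  proof cases
    case contract
    then show ?thesis
    proof cases
      case (beta \<sigma> B)
      with M obtain B' where "M' = Lam \<sigma> B'" "B \<Rrightarrow> B'" by auto
      with beta N show ?thesis
        using contractD [of "subst 0 N' B'"] by (auto intro: contract.beta par_subst)
    next
      case (case0 \<sigma> \<tau> \<rho> \<sigma>' \<tau>' x y)
      with M obtain x' y' where
        "M' = Const (Case \<sigma> \<tau> \<rho>) \<bullet> (Const (In0 \<sigma>' \<tau>') \<bullet> x') \<bullet> y'" "x \<Rrightarrow> x'" "y \<Rrightarrow> y'"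
        by (auto elim!: par_Case2E par_In0E)
      with case0 show ?thesis
        using contractD [of "y' \<bullet> x'"] by (auto intro: contract.case0 par.app)
    next
      case (case1 \<sigma> \<tau> \<rho> \<sigma>' \<tau>' x y)
      with M obtain x' y' where
        "M' = Const (Case \<sigma> \<tau> \<rho>) \<bullet> (Const (In1 \<sigma>' \<tau>') \<bullet> x') \<bullet> y'" "x \<Rrightarrow> x'"
        by (auto elim!: par_Case2E par_In1E)
      with case1 N show ?thesis
        using contractD [of "N' \<bullet> x'"] by (auto intro: contract.case1 par.app)
    next
      case (fst \<sigma> \<tau> \<sigma>' \<tau>' y)
      with N obtain x' y' where "N' = Const (Pair \<sigma>' \<tau>') \<bullet> x' \<bullet> y'" "P \<Rrightarrow> x'"
        by (auto elim!: par_PairE)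
      with fst M show ?thesis
        using contractD [of x'] by (auto intro: contract.fst)
    next
      case (snd \<sigma> \<tau> \<sigma>' \<tau>' x)
      with N obtain x' y' where "N' = Const (Pair \<sigma>' \<tau>') \<bullet> x' \<bullet> y'" "P \<Rrightarrow> y'"
        by (auto elim!: par_PairE)
      with snd M show ?thesis
        using contractD [of y'] by (auto intro: contract.snd)
    next
      case (pcase0 \<sigma> \<tau> \<rho> \<sigma>' \<tau>' x)
      with M obtain x' y' where
        "M' = Const (PCase \<sigma> \<tau> \<rho>) \<bullet> (Const (In0 \<sigma>' \<tau>') \<bullet> x') \<bullet> y'" "P \<Rrightarrow> y'"
        by (auto elim!: par_PCase2E par_In0E)
      then show ?thesis
        using contractD [of y'] by (auto intro: contract.pcase0)
    next
      case (pcase1 \<sigma> \<tau> \<rho> \<sigma>' \<tau>' x y)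
      with M obtain x' y' where
        "M' = Const (PCase \<sigma> \<tau> \<rho>) \<bullet> (Const (In1 \<sigma>' \<tau>') \<bullet> x') \<bullet> y'"
        by (auto elim!: par_PCase2E par_In1E)
      with pcase1 N show ?thesis
        using contractD [of N'] by (auto intro: contract.pcase1)
    qed
  next
    case push
    note pushD = greatest_root_reduct_push [OF L]
    from push show ?thesis
    proof cases
      case (in0 \<sigma> \<tau> \<rho>\<^sub>0 \<rho>\<^sub>1 x \<rho>\<^sub>0' \<rho>\<^sub>1' y z)
      let ?In = "Const (In0 \<rho>\<^sub>0' \<rho>\<^sub>1')"
      from in0 M N obtain x' y' z' where
        M': "M' = Const (PCase \<sigma> \<tau> (TSum \<rho>\<^sub>0 \<rho>\<^sub>1)) \<bullet> x' \<bullet> (?In \<bullet> y')" and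
        N': "N' = ?In \<bullet> z'" and par: "x \<Rrightarrow> x'" "y \<Rrightarrow> y'" "z \<Rrightarrow> z'"
        by (auto elim!: par_PCase2E par_In0E)
      \<comment> \<open>If \<open>L\<close> is not the result of the push, then \<open>x'\<close> is
        an injection and \<open>L\<close> is one of the two arguments
        \<open>?In \<bullet> y'\<close> and \<open>?In \<bullet> z'\<close>. The
        \<open>pcase\<close> that the push left under \<open>?In\<close> then projects to the same
        component.\<close>
      have "contract (M' \<bullet> N') L \<or> L = ?In \<bullet> (Const (PCase \<sigma> \<tau> \<rho>\<^sub>0) \<bullet> x' \<bullet> y' \<bullet> z')"
        by (rule pushD) (auto simp: M' N' intro: pcase_push.in0)
      then show ?thesis
        using par unfolding M' N' in0
        by (auto elim!: contract.cases intro!: par.app [OF par.const] intro: par_pcase par_pcase0 par_pcase1)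
    next
      case (in1 \<sigma> \<tau> \<rho>\<^sub>0 \<rho>\<^sub>1 x \<rho>\<^sub>0' \<rho>\<^sub>1' y z)
      let ?In = "Const (In1 \<rho>\<^sub>0' \<rho>\<^sub>1')"
      from in1 M N obtain x' y' z' where
        M': "M' = Const (PCase \<sigma> \<tau> (TSum \<rho>\<^sub>0 \<rho>\<^sub>1)) \<bullet> x' \<bullet> (?In \<bullet> y')" and
        N': "N' = ?In \<bullet> z'" and par: "x \<Rrightarrow> x'" "y \<Rrightarrow> y'" "z \<Rrightarrow> z'"
        by (auto elim!: par_PCase2E par_In1E)
      have "contract (M' \<bullet> N') L \<or> L = ?In \<bullet> (Const (PCase \<sigma> \<tau> \<rho>\<^sub>1) \<bullet> x' \<bullet> y' \<bullet> z')"
        by (rule pushD) (auto simp: M' N' intro: pcase_push.in1)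
      then show ?thesis
        using par unfolding M' N' in1
        by (auto elim!: contract.cases intro!: par.app [OF par.const] intro: par_pcase par_pcase0 par_pcase1)
    next
      case (pair \<sigma> \<tau> \<rho>\<^sub>1 \<rho>\<^sub>2 x \<rho>\<^sub>1' \<rho>\<^sub>2' y\<^sub>1 y\<^sub>2 z\<^sub>1 z\<^sub>2)
      let ?Pair = "Const (Pair \<rho>\<^sub>1' \<rho>\<^sub>2')"
      from pair M N obtain x' y\<^sub>1' y\<^sub>2' z\<^sub>1' z\<^sub>2' where
        M': "M' = Const (PCase \<sigma> \<tau> (TProd \<rho>\<^sub>1 \<rho>\<^sub>2)) \<bullet> x' \<bullet> (?Pair \<bullet> y\<^sub>1' \<bullet> y\<^sub>2')" and
        N': "N' = ?Pair \<bullet> z\<^sub>1' \<bullet> z\<^sub>2'" and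
        par: "x \<Rrightarrow> x'" "y\<^sub>1 \<Rrightarrow> y\<^sub>1'" "y\<^sub>2 \<Rrightarrow> y\<^sub>2'" "z\<^sub>1 \<Rrightarrow> z\<^sub>1'" "z\<^sub>2 \<Rrightarrow> z\<^sub>2'"
        by (auto elim!: par_PCase2E par_PairE)
      \<comment> \<open>The push copies the scrutinee, so if \<open>x'\<close> is an injection, both
        component \<open>pcase\<close> terms project to the same side and rebuild the chosen
        pair.\<close>
      have "contract (M' \<bullet> N') L \<or>
          L = ?Pair \<bullet> (Const (PCase \<sigma> \<tau> \<rho>\<^sub>1) \<bullet> x' \<bullet> y\<^sub>1' \<bullet> z\<^sub>1') \<bullet> (Const (PCase \<sigma> \<tau> \<rho>\<^sub>2) \<bullet> x' \<bullet> y\<^sub>2' \<bullet> z\<^sub>2')"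
        by (rule pushD) (auto simp: M' N' intro: pcase_push.pair)
      then show ?thesis
        using par unfolding M' N' pair
        by (auto elim!: contract.cases intro!: par.app [OF par.app [OF par.const]]
            intro: par_pcase par_pcase0 par_pcase1)
    next
      case (func \<sigma> \<tau> \<rho>\<^sub>1 \<rho>\<^sub>2 x y z)
      \<comment> \<open>For \<open>y\<close> or \<open>z\<close> stepping to \<open>M'\<close>, this
        gives a step from \<open>y \<bullet> N\<close> or \<open>z \<bullet> N\<close> to
        \<open>L\<close>. It serves the cases where the inner \<open>pcase\<close> is projected and
        no \<open>func\<close> redex is left to push: \<open>P\<close> then projects to that
        application and reduces it to \<open>L\<close> in the same step.\<close>
      note appL = par_greatest_root_reduct [OF _ N L]
      from M [unfolded func] show ?thesis
      proof (cases rule: par_PCase_fun3E)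
        case (cong x' y' z')
        have "contract (M' \<bullet> N') L \<or> L = Const (PCase \<sigma> \<tau> \<rho>\<^sub>2) \<bullet> x' \<bullet> (y' \<bullet> N') \<bullet> (z' \<bullet> N')"
          by (rule pushD) (auto simp: cong intro: pcase_push.func)
        \<comment> \<open>A \<open>pcase\<close> with four arguments is not itself a projection
          redex, so here the push is the greatest reduct.\<close>
        moreover have "\<not> contract (M' \<bullet> N') L"
          by (auto simp: cong elim: contract.cases)
        ultimately show ?thesis
          using cong N by (auto simp: func intro: par_pcase par.app)
      next
        case proj0
        then show ?thesis by (auto simp: func intro: par_pcase0 appL)
      next
        case proj1
        then show ?thesis by (auto simp: func intro: par_pcase1 appL)
      qed
    qed
  qed
qed

text \<open>The witness \<open>L\<close> depends on \<open>M\<close> alone, which makes any two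
  parallel reducts of \<open>M\<close> meet in one step.\<close>

lemma par_triangle: "\<exists>L. \<forall>N. M \<Rrightarrow> N \<longrightarrow> N \<Rrightarrow> L"
proof (induction M)
  case (Lam \<sigma> M)
  then obtain L where "\<forall>N. M \<Rrightarrow> N \<longrightarrow> N \<Rrightarrow> L" by blast
  then have "\<forall>N. Lam \<sigma> M \<Rrightarrow> N \<longrightarrow> N \<Rrightarrow> Lam \<sigma> L" by (auto intro: par.lam)
  then show ?case ..
next
  case (App M\<^sub>1 M\<^sub>2)
  then obtain L\<^sub>1 L\<^sub>2 where IH: "M\<^sub>1 \<Rrightarrow> N\<^sub>1 \<Longrightarrow> N\<^sub>1 \<Rrightarrow> L\<^sub>1" "M\<^sub>2 \<Rrightarrow> N\<^sub>2 \<Longrightarrow> N\<^sub>2 \<Rrightarrow> L\<^sub>2" for N\<^sub>1 N\<^sub>2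
    by blast
  obtain L where L: "greatest_root_reduct (L\<^sub>1 \<bullet> L\<^sub>2) L"
    using greatest_root_reduct_exists by blast
  \<comment> \<open>If \<open>N\<close> comes from rule \<open>app\<close>,
    \<open>par_greatest_root_reduct\<close> leads to \<open>L\<close>. If it comes from rule
    \<open>root\<close>, \<open>root_red_triangle\<close> does, applied to the reducts of the parts
    and their bounds \<open>L\<^sub>1\<close> and \<open>L\<^sub>2\<close>.\<close>
  have "N \<Rrightarrow> L" if "M\<^sub>1 \<bullet> M\<^sub>2 \<Rrightarrow> N" for N
    using that by (cases rule: par_AppE)
      (blast intro: par_greatest_root_reduct [OF _ _ L] root_red_triangle [OF _ _ L] dest: IH)+
  then show ?case by blast
qed (blast elim: par_FreeE par_BoundE intro: par_refl)+

section \<open>From the triangle to confluence\<close>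

lemma reds_eq_pars: "red\<^sup>*\<^sup>* = par\<^sup>*\<^sup>*"
proof (rule antisym)
  show "red\<^sup>*\<^sup>* \<le> par\<^sup>*\<^sup>*"
    by (rule rtranclp_mono) (auto intro: red_imp_par)
  have "par\<^sup>*\<^sup>* \<le> red\<^sup>*\<^sup>*\<^sup>*\<^sup>*"
    by (rule rtranclp_mono) (auto intro: par_imp_reds)
  then show "par\<^sup>*\<^sup>* \<le> red\<^sup>*\<^sup>*" by simp
qed

lemma confluentp_par: "confluentp par"
proof (rule strong_confluentp_imp_confluentp, rule strong_confluentpI)
  fix M N P
  assume "M \<Rrightarrow> N" and "M \<Rrightarrow> P"
  with par_triangle [of M] obtain L where "N \<Rrightarrow> L" "P \<Rrightarrow> L" by blast
  \<comment> \<open>Strong confluence allows many steps on one side and at most one on the other;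
    the diamond supplies exactly one on each.\<close>
  then show "\<exists>u. par\<^sup>*\<^sup>* N u \<and> par\<^sup>=\<^sup>= P u" by blast
qed

theorem mainTheorem3:
  fixes M N P :: trm
  assumes "typed M"
    and "red\<^sup>*\<^sup>* M N"
    and "red\<^sup>*\<^sup>* M P"
  shows "\<exists>Q. red\<^sup>*\<^sup>* N Q \<and> red\<^sup>*\<^sup>* P Q"
  using confluentpD [OF confluentp_par] assms(2,3) unfolding reds_eq_pars by blast

end
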